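(* Let $k\ge 3$ be an integer and let $A\in SL_n(\mathbb{C})$. If there is a matrix $B\in SL_n(\mathbb{C})$ such that $A=B^k$ and $B$ is the product of two $n\times n$ complex matrices of order $k$, then $A$ is a product of $2k-3$ commutators of elements of order $k$.
   Context: A matrix $X\in GL_n(\mathbb C)$ is said to be of order $k$ if $X^k=I$ (the exact order may be a proper divisor of $k$). The commutator is $[X,Y]=XYX^{-1}Y^{-1}$; a commutator of elements of order $k$ is $[X,Y]$ with $X,Y\in GL_n(\mathbb{C})$ and $X^k=Y^k=I$. *)

theory Defs
  imports "Jordan_Normal_Form.Matrix" "Jordan_Normal_Form.Determinant" "HOL-Algebra.Group"
begin

definition GL :: "nat \<Rightarrow> complex mat monoid" where
  "GL n = units_of (ring_mat TYPE(complex) n ())"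

definition SL :: "nat \<Rightarrow> complex mat set" where
  "SL n = {A \<in> carrier_mat n n. det A = 1}"

(* "Of order k" only requires X^k = I; the exact order may be a proper divisor of k. *)
definition of_order :: "nat \<Rightarrow> nat \<Rightarrow> complex mat \<Rightarrow> bool" where
  "of_order n k X \<longleftrightarrow> X \<in> carrier (GL n) \<and> X ^\<^sub>m k = 1\<^sub>m n"

definition commutator :: "nat \<Rightarrow> complex mat \<Rightarrow> complex mat \<Rightarrow> complex mat" where
  "commutator n X Y = X * Y * inv\<^bsub>GL n\<^esub> X * inv\<^bsub>GL n\<^esub> Y"

definition order_commutators :: "nat \<Rightarrow> nat \<Rightarrow> complex mat set" where
  "order_commutators n k = {commutator n X Y | X Y. of_order n k X \<and> of_order n k Y}"

definition mat_product :: "nat \<Rightarrow> complex mat list \<Rightarrow> complex mat" where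
  "mat_product n Cs = foldr (*) Cs (1\<^sub>m n)"

end

theory Submission
  imports Defs
begin

text \<open>
  The statement is purely group theoretic. If \<open>(xy)\<^sup>m = P y\<^sup>m x\<^sup>m\<close>, then
  \<open>(xy)\<^sup>m\<^sup>+\<^sup>1 = P y\<^sup>m x\<^sup>m\<^sup>+\<^sup>1 y = P [y\<^sup>m x\<^sup>m\<^sup>+\<^sup>1 y\<^sup>-\<^sup>m, y] y\<^sup>m\<^sup>+\<^sup>1 x\<^sup>m\<^sup>+\<^sup>1\<close>, and both entries of the
  new commutator have order \<open>k\<close> if \<open>x\<close> and \<open>y\<close> do. Hence \<open>(xy)\<^sup>k\<close> is a product of \<open>k\<close>
  commutators, which suffices because \<open>k \<le> 2k - 3\<close> and \<open>[1, 1] = 1\<close> serves as padding.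
\<close>

lemma (in group) inv_mult_cancel_left:
  assumes "x \<in> carrier G" "y \<in> carrier G"
  shows "inv x \<otimes> (x \<otimes> y) = y"
  using assms by (simp add: m_assoc[symmetric])

lemma (in group) conj_pow:
  assumes "x \<in> carrier G" "g \<in> carrier G"
  shows "(g \<otimes> x \<otimes> inv g) [^] (k::nat) = g \<otimes> x [^] k \<otimes> inv g"
proof (induction k)
  case 0
  then show ?case using assms by simp
next
  case (Suc k)
  then show ?case using assms by (simp add: m_assoc inv_mult_cancel_left)
qed

lemma (in group) pow_pow_eq_one:
  assumes "x \<in> carrier G" "x [^] (k::nat) = \<one>"
  shows "(x [^] (m::nat)) [^] k = \<one>"
  using assms by (metis nat_pow_one nat_pow_pow mult.commute)

lemma (in group) foldr_mult_closed:
  assumes "set xs \<subseteq> carrier G" "z \<in> carrier G"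
  shows "foldr (\<otimes>) xs z \<in> carrier G"
  using assms by (induction xs) auto

text \<open>Appending an element to a list changes the seed of \<open>foldr\<close>; pulling the
  seed out as a right factor turns an appended commutator into a multiplication on the
  right.\<close>

lemma (in group) foldr_mult_shift:
  assumes "set xs \<subseteq> carrier G" "z \<in> carrier G"
  shows "foldr (\<otimes>) xs z = foldr (\<otimes>) xs \<one> \<otimes> z"
  using assms by (induction xs) (auto simp: m_assoc foldr_mult_closed)

text \<open>The exponent \<open>m\<close> is kept apart from the order \<open>k\<close> so that
  induction on \<open>m\<close> can run with \<open>k\<close> fixed. At \<open>m = k\<close> the
  trailing factor becomes trivial.\<close>

lemma (in group) pow_mult_eq_commutators:
  fixes k m :: nat
  assumes x: "x \<in> carrier G" "x [^] k = \<one>" and y: "y \<in> carrier G" "y [^] k = \<one>"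
  shows "\<exists>Cs. length Cs = m \<and>
    set Cs \<subseteq> {a \<otimes> b \<otimes> inv a \<otimes> inv b | a b.
      a \<in> carrier G \<and> b \<in> carrier G \<and> a [^] k = \<one> \<and> b [^] k = \<one>} \<and>
    (x \<otimes> y) [^] m = foldr (\<otimes>) Cs \<one> \<otimes> (y [^] m \<otimes> x [^] m)"
    (is "\<exists>Cs. _ \<and> set Cs \<subseteq> ?K \<and> _")
proof (induction m)
  case 0
  then show ?case by simp
next
  case (Suc m)
  then obtain Cs where Cs: "length Cs = m" "set Cs \<subseteq> ?K"
    and eq: "(x \<otimes> y) [^] m = foldr (\<otimes>) Cs \<one> \<otimes> (y [^] m \<otimes> x [^] m)" by blast
  have Cs_carrier: "set Cs \<subseteq> carrier G" using Cs(2) by fastforce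
  \<comment> \<open>The exponents differ by one: the \<open>x\<close> of the new factor
    \<open>x \<otimes> y\<close> is absorbed into the power of \<open>x\<close> on its left, while
    the new \<open>y\<close> remains to be moved.\<close>
  define u where "u = x [^] Suc m"
  define v where "v = y [^] m"
  \<comment> \<open>Chosen so that \<open>a \<otimes> v = v \<otimes> u\<close>; the commutator
    \<open>c\<close> of \<open>a\<close> and \<open>y\<close> then accounts for moving
    \<open>y\<close> leftwards past \<open>u\<close>.\<close>
  define a where "a = v \<otimes> u \<otimes> inv v"
  define c where "c = a \<otimes> y \<otimes> inv a \<otimes> inv y"
  define P where "P = foldr (\<otimes>) Cs \<one>"
  have P: "P \<in> carrier G" unfolding P_def by (rule foldr_mult_closed[OF Cs_carrier]) simp
  have u: "u \<in> carrier G" and v: "v \<in> carrier G" using x y by (auto simp: u_def v_def)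
  have a: "a \<in> carrier G" and c: "c \<in> carrier G" using u v y by (auto simp: a_def c_def)
  have "u [^] k = \<one>" unfolding u_def by (rule pow_pow_eq_one[OF x])
  then have "a [^] k = \<one>" unfolding a_def using u v by (simp add: conj_pow)
  then have "c \<in> ?K" using a y unfolding c_def by blast
  moreover have "c \<otimes> (v \<otimes> y \<otimes> u) = v \<otimes> u \<otimes> y"
  proof -
    \<comment> \<open>Since \<open>y\<close> commutes with its own power \<open>v\<close>, it can be
      brought to the front, next to the \<open>inv y\<close> that ends \<open>c\<close>.\<close>
    have vy: "v \<otimes> y = y \<otimes> v" unfolding v_def using y nat_pow_comm[of y m 1] by simp
    have "v \<otimes> y \<otimes> u = y \<otimes> a \<otimes> v"
      unfolding vy a_def using u v y by (simp add: m_assoc)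
    \<comment> \<open>The tail \<open>inv a \<otimes> inv y\<close> of \<open>c\<close> cancels
      against \<open>y \<otimes> a\<close>.\<close>
    then have "c \<otimes> (v \<otimes> y \<otimes> u) = a \<otimes> y \<otimes> v"
      using a v y by (simp add: c_def m_assoc inv_mult_cancel_left)
    also have "\<dots> = a \<otimes> v \<otimes> y" using a v y vy by (simp add: m_assoc)
    also have "\<dots> = v \<otimes> u \<otimes> y" using u v y by (simp add: a_def m_assoc)
    finally show ?thesis .
  qed
  then have "P \<otimes> (v \<otimes> u \<otimes> y) = P \<otimes> c \<otimes> (v \<otimes> y \<otimes> u)"
    using P c u v y by (simp add: m_assoc)
  moreover have "foldr (\<otimes>) (Cs @ [c]) \<one> = P \<otimes> c"
    using foldr_mult_shift[OF Cs_carrier c] c by (simp add: P_def)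
  moreover have "(x \<otimes> y) [^] Suc m = P \<otimes> (v \<otimes> u \<otimes> y)"
    using P v x y eq by (simp add: P_def[symmetric] v_def[symmetric] u_def m_assoc)
  moreover have "v \<otimes> y = y [^] Suc m" by (simp add: v_def)
  ultimately show ?case using Cs by (intro exI[of _ "Cs @ [c]"]) (simp add: u_def)
qed

lemma group_GL: "group (GL n)"
proof -
  interpret ring "ring_mat TYPE(complex) n ()" by (rule ring_mat)
  show ?thesis unfolding GL_def by (rule units_group)
qed

text \<open>An equation between functions, without arguments, also rewrites the operator passed to
  \<open>foldr\<close>.\<close>

lemma GL_mult: "(\<otimes>\<^bsub>GL n\<^esub>) = (*)" and GL_one: "\<one>\<^bsub>GL n\<^esub> = 1\<^sub>m n"
  by (simp_all add: GL_def units_of_mult units_of_one ring_mat_def)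

lemma GL_pow:
  assumes "X \<in> carrier (GL n)"
  shows "X [^]\<^bsub>GL n\<^esub> (k::nat) = X ^\<^sub>m k"
proof -
  interpret group "GL n" by (rule group_GL)
  \<comment> \<open>Needed for exponent 0, where the matrix power is the identity of size
    \<open>dim_row X\<close>.\<close>
  have "dim_row X = n"
    using assms by (auto simp: GL_def units_of_def Units_def ring_mat_def)
  then show ?thesis by (induction k) (simp_all add: GL_mult GL_one)
qed

theorem theorem1p3:
  fixes n k :: nat and A :: "complex mat"
  assumes "k \<ge> 3"
    and "A \<in> SL n"
    and "\<exists>B \<in> SL n. A = B ^\<^sub>m k \<and>
           (\<exists>X Y. of_order n k X \<and> of_order n k Y \<and> B = X * Y)"
  shows "\<exists>Cs. length Cs = 2 * k - 3 \<and> set Cs \<subseteq> order_commutators n k \<and>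
           A = mat_product n Cs"
proof -
  interpret group "GL n" by (rule group_GL)
  have order_iff: "of_order n k Z \<longleftrightarrow> Z \<in> carrier (GL n) \<and> Z [^]\<^bsub>GL n\<^esub> k = \<one>\<^bsub>GL n\<^esub>" for Z
    by (auto simp: of_order_def GL_pow GL_one)
  have commutators_eq: "order_commutators n k =
    {a \<otimes>\<^bsub>GL n\<^esub> b \<otimes>\<^bsub>GL n\<^esub> inv\<^bsub>GL n\<^esub> a \<otimes>\<^bsub>GL n\<^esub> inv\<^bsub>GL n\<^esub> b | a b.
      a \<in> carrier (GL n) \<and> b \<in> carrier (GL n) \<and>
      a [^]\<^bsub>GL n\<^esub> k = \<one>\<^bsub>GL n\<^esub> \<and> b [^]\<^bsub>GL n\<^esub> k = \<one>\<^bsub>GL n\<^esub>}"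
    unfolding order_commutators_def commutator_def order_iff GL_mult by blast
  obtain X Y where X: "of_order n k X" and Y: "of_order n k Y" and A: "A = (X * Y) ^\<^sub>m k"
    using assms(3) by blast
  obtain Cs where Cs: "length Cs = k" "set Cs \<subseteq> order_commutators n k"
    and eq: "(X \<otimes>\<^bsub>GL n\<^esub> Y) [^]\<^bsub>GL n\<^esub> k = foldr (\<otimes>\<^bsub>GL n\<^esub>) Cs \<one>\<^bsub>GL n\<^esub>
      \<otimes>\<^bsub>GL n\<^esub> (Y [^]\<^bsub>GL n\<^esub> k \<otimes>\<^bsub>GL n\<^esub> X [^]\<^bsub>GL n\<^esub> k)"
    using pow_mult_eq_commutators[of X k Y k] X Y
    unfolding order_iff commutators_eq by blast
  have "set Cs \<subseteq> carrier (GL n)" using Cs(2) unfolding commutators_eq by fastforce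
  \<comment> \<open>The trailing factor vanishes because the \<open>k\<close>-th powers of
    \<open>X\<close> and \<open>Y\<close> are the identity.\<close>
  then have "A = foldr (\<otimes>\<^bsub>GL n\<^esub>) Cs \<one>\<^bsub>GL n\<^esub>"
    unfolding A GL_mult[of n, symmetric]
    using X Y eq foldr_mult_closed[of Cs "\<one>\<^bsub>GL n\<^esub>"] GL_pow[of "X \<otimes>\<^bsub>GL n\<^esub> Y" n k]
    by (simp add: order_iff)
  moreover have one: "\<one>\<^bsub>GL n\<^esub> \<in> order_commutators n k"
    unfolding commutators_eq
    by (intro CollectI exI[of _ "\<one>\<^bsub>GL n\<^esub>"]) simp
  \<comment> \<open>In an appended list \<open>foldr\<close> evaluates the padding first, and its
    value is the seed for \<open>Cs\<close>.\<close>
  moreover have "foldr (\<otimes>\<^bsub>GL n\<^esub>) (replicate j \<one>\<^bsub>GL n\<^esub>) \<one>\<^bsub>GL n\<^esub> = \<one>\<^bsub>GL n\<^esub>" for j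
    by (induction j) simp_all
  ultimately have "A = mat_product n (Cs @ replicate (k - 3) \<one>\<^bsub>GL n\<^esub>)"
    unfolding mat_product_def GL_mult[symmetric, of n] GL_one[symmetric] by simp
  \<comment> \<open>Subtraction on naturals truncates; \<open>k \<ge> 3\<close> makes
    \<open>k + (k - 3)\<close> equal to \<open>2 * k - 3\<close>.\<close>
  moreover have "length (Cs @ replicate (k - 3) \<one>\<^bsub>GL n\<^esub>) = 2 * k - 3"
    using Cs(1) assms(1) by simp
  moreover have "set (Cs @ replicate (k - 3) \<one>\<^bsub>GL n\<^esub>) \<subseteq> order_commutators n k"
    using Cs(2) one by auto
  ultimately show ?thesis by blast
qed

end
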